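(* Every degree $3$-critical graph $G$ on $n\geq 6$ vertices contains a cycle of length $6$.
   Context: All graphs are finite and simple. A subgraph $H$ of a graph $G$ is proper if $H\neq G$. A graph $G$ is called degree $3$-critical if, with $n$ denoting its number of vertices, it has exactly $2n-2$ edges and it has no proper induced subgraph of minimum degree $3$ (where "minimum degree $3$" may be read as "minimum degree at least $3$"). "Contains a cycle of length $6$" means contains a (not necessarily induced) subgraph isomorphic to $C_6$. *)

theory Defs
  imports Main
begin

text \<open>A graph is a pair of a vertex set and a set of edges, the edges being unordered pairs
  of vertices, represented as two-element sets.\<close>

type_synonym 'a ugraph = "'a set \<times> 'a set set"

abbreviation verts :: "'a ugraph \<Rightarrow> 'a set" where
  "verts G \<equiv> fst G"

abbreviation edges :: "'a ugraph \<Rightarrow> 'a set set" where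
  "edges G \<equiv> snd G"

definition simple_graph :: "'a ugraph \<Rightarrow> bool" where
  "simple_graph G \<longleftrightarrow> finite (verts G) \<and> (\<forall>e\<in>edges G. e \<subseteq> verts G \<and> card e = 2)"

definition subgraph :: "'a ugraph \<Rightarrow> 'a ugraph \<Rightarrow> bool" where
  "subgraph H G \<longleftrightarrow> simple_graph H \<and> verts H \<subseteq> verts G \<and> edges H \<subseteq> edges G"

definition induced_subgraph :: "'a ugraph \<Rightarrow> 'a ugraph \<Rightarrow> bool" where
  "induced_subgraph H G \<longleftrightarrow> subgraph H G \<and> edges H = {e \<in> edges G. e \<subseteq> verts H}"

definition vertex_degree :: "'a ugraph \<Rightarrow> 'a \<Rightarrow> nat" where
  "vertex_degree G v = card {e \<in> edges G. v \<in> e}"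

text \<open>Meaningful only if \<open>G\<close> has at least one vertex.\<close>

definition min_degree :: "'a ugraph \<Rightarrow> nat" where
  "min_degree G = Min (vertex_degree G ` verts G)"

text \<open>The edge count \<open>2 n - 2\<close> is stated additively to avoid truncated subtraction.
  The graph without vertices has no minimum degree, hence the nonemptiness condition.\<close>

definition degree_3_critical :: "'a ugraph \<Rightarrow> bool" where
  "degree_3_critical G \<longleftrightarrow>
     simple_graph G \<and>
     card (edges G) + 2 = 2 * card (verts G) \<and>
     \<not> (\<exists>H. induced_subgraph H G \<and> H \<noteq> G \<and> verts H \<noteq> {} \<and> min_degree H \<ge> 3)"

definition graph_iso :: "'a ugraph \<Rightarrow> 'b ugraph \<Rightarrow> bool" where
  "graph_iso G H \<longleftrightarrow>
     (\<exists>f. bij_betw f (verts G) (verts H) \<and>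
          (\<forall>u\<in>verts G. \<forall>v\<in>verts G. {u, v} \<in> edges G \<longleftrightarrow> {f u, f v} \<in> edges H))"

text \<open>The cycle \<open>C\<^sub>k\<close> on the vertices \<open>0, \<dots>, k - 1\<close>; a simple graph for \<open>k \<ge> 3\<close>.\<close>

definition cycle_graph :: "nat \<Rightarrow> nat ugraph" where
  "cycle_graph k = ({..<k}, {{i, (i + 1) mod k} | i. i < k})"

definition contains_cycle_of_length :: "'a ugraph \<Rightarrow> nat \<Rightarrow> bool" where
  "contains_cycle_of_length G k \<longleftrightarrow> (\<exists>H. subgraph H G \<and> graph_iso H (cycle_graph k))"

end

theory Submission
  imports Defs
begin

text \<open>Removing a vertex \<open>v\<close> of degree 3 leaves a graph with \<open>m\<close> vertices and \<open>2 m - 3\<close> edges all of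
  whose induced subgraphs have a vertex of degree at most 2; by counting, it arises from an edge by
  successively adding vertices of degree exactly 2. As long as no 6-cycle appears, such a process
  stays within three explicit families: each consists of a few core vertices and many leaves of
  degree 2. Since \<open>G\<close> has minimum degree 3, \<open>v\<close> is adjacent to all leaves, and this closes a
  6-cycle.\<close>

section \<open>Six-cycles given by explicit vertices\<close>

definition edges_in :: "'a ugraph \<Rightarrow> 'a set \<Rightarrow> 'a set set" where
  "edges_in G S = {e \<in> edges G. e \<subseteq> S}"

definition nbhd :: "'a ugraph \<Rightarrow> 'a set \<Rightarrow> 'a \<Rightarrow> 'a set" where
  "nbhd G S v = {u \<in> S. {v, u} \<in> edges G}"

text \<open>A form of containment free of subgraphs and isomorphisms, so that a cycle can be
  exhibited by naming its vertices in order. Only edges are mentioned; that the vertices belong to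
  \<open>G\<close> follows when \<open>G\<close> is simple.\<close>

definition has_six_cycle :: "'a ugraph \<Rightarrow> bool" where
  "has_six_cycle G \<longleftrightarrow> (\<exists>a b c d e f. distinct [a, b, c, d, e, f] \<and>
     {{a, b}, {b, c}, {c, d}, {d, e}, {e, f}, {f, a}} \<subseteq> edges G)"

lemma six_cycleI:
  assumes "{a, b} \<in> edges G" "{b, c} \<in> edges G" "{c, d} \<in> edges G" "{d, e} \<in> edges G"
    "{e, f} \<in> edges G" "{f, a} \<in> edges G" "distinct [a, b, c, d, e, f]"
  shows "has_six_cycle G"
  unfolding has_six_cycle_def
  by (intro exI[of _ a] exI[of _ b] exI[of _ c] exI[of _ d] exI[of _ e] exI[of _ f])
    (use assms in simp)

lemma contains_cycle_if_has_six_cycle: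
  assumes G: "simple_graph G" and C: "has_six_cycle G"
  shows "contains_cycle_of_length G 6"
proof -
  obtain a b c d e f where dist: "distinct [a, b, c, d, e, f]"
    and sub: "{{a, b}, {b, c}, {c, d}, {d, e}, {e, f}, {f, a}} \<subseteq> edges G"
    using C unfolding has_six_cycle_def by (elim exE conjE)
  let ?V = "{a, b, c, d, e, f}"
  let ?E = "{{a, b}, {b, c}, {c, d}, {d, e}, {e, f}, {f, a}}"
  define h :: "'a \<Rightarrow> nat" where "h = (\<lambda>u. if u = a then 0 else if u = b then 1 else
    if u = c then 2 else if u = d then 3 else if u = e then 4 else 5)"
  have h: "h a = 0" "h b = 1" "h c = 2" "h d = 3" "h e = 4" "h f = 5"
    using dist by (auto simp: h_def)
  have lt6: "i < 6 \<longleftrightarrow> i = 0 \<or> i = 1 \<or> i = 2 \<or> i = 3 \<or> i = 4 \<or> i = 5" for i :: nat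
    by auto
  have verts6: "{..<6::nat} = {0, 1, 2, 3, 4, 5}"
    by (auto simp: lt6)
  have "{{i, (i + 1) mod 6} | i. i < 6} = (\<lambda>i. {i, (i + 1) mod 6}) ` {..<6::nat}"
    by auto
  also have "\<dots> = {{0, 1}, {1, 2}, {2, 3}, {3, 4}, {4, 5}, {5, 0}}"
    unfolding verts6 by (simp flip: numeral_2_eq_2)
  finally have edges6: "{{i, (i + 1) mod 6} | i. i < 6} =
    {{0, 1}, {1, 2}, {2, 3}, {3, 4}, {4, 5}, {5, 0::nat}}" .
  have inj: "inj_on h ?V"
    using dist by (simp add: h)
  then have "bij_betw h ?V {..<6}"
    unfolding bij_betw_def verts6 by (simp add: h)
  moreover have "\<forall>u\<in>?V. \<forall>v\<in>?V. {u, v} \<in> ?E \<longleftrightarrow>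
      {h u, h v} \<in> {{0, 1}, {1, 2}, {2, 3}, {3, 4}, {4, 5}, {5, 0}}"
  proof (intro ballI)
    fix u v assume uv: "u \<in> ?V" "v \<in> ?V"
    \<comment> \<open>Both directions of the equivalence come from injectivity of the image map on
      \<open>Pow ?V\<close>: a vertex pair lies in \<open>?E\<close> exactly when its image lies in
      the image of \<open>?E\<close>. This avoids checking all pairs \<open>u\<close>,
      \<open>v\<close>.\<close>
    have "{h u, h v} = h ` {u, v}"
      by simp
    moreover have "{{0, 1}, {1, 2}, {2, 3}, {3, 4}, {4, 5}, {5, 0}} = (`) h ` ?E"
      by (simp add: h)
    moreover have "{u, v} \<in> Pow ?V" "?E \<subseteq> Pow ?V"
      using uv by simp_all
    ultimately show "{u, v} \<in> ?E \<longleftrightarrow>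
        {h u, h v} \<in> {{0, 1}, {1, 2}, {2, 3}, {3, 4}, {4, 5}, {5, 0}}"
      using inj_on_image_mem_iff[OF inj_on_image_Pow[OF inj]] by metis
  qed
  ultimately have "graph_iso (?V, ?E) (cycle_graph 6)"
    unfolding graph_iso_def cycle_graph_def fst_conv snd_conv edges6 by blast
  moreover have "subgraph (?V, ?E) G"
  proof -
    have E: "e \<subseteq> verts G \<and> card e = 2" if "e \<in> ?E" for e
      using G sub that unfolding simple_graph_def by (meson subsetD)
    \<comment> \<open>Each of the six vertices lies on one of the six edges, and edges of
      \<open>G\<close> lie inside \<open>verts G\<close>.\<close>
    have "?V = \<Union> ?E"
      by (simp add: insert_commute)
    then have "?V \<subseteq> verts G" and "\<forall>e\<in>?E. e \<subseteq> ?V"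
      using E by (simp_all only: Sup_le_iff Union_upper ball_simps) blast+
    then show ?thesis
      unfolding subgraph_def simple_graph_def fst_conv snd_conv using E sub by blast
  qed
  ultimately show ?thesis
    unfolding contains_cycle_of_length_def by blast
qed

section \<open>Counting edges and degrees\<close>

lemma edge_neq:
  assumes "simple_graph G" "{u, v} \<in> edges G"
  shows "u \<noteq> v"
  using assms unfolding simple_graph_def by fastforce

lemma finite_edges:
  assumes "simple_graph G"
  shows "finite (edges G)"
  by (rule finite_subset[of _ "Pow (verts G)"]) (use assms in \<open>auto simp: simple_graph_def\<close>)

lemma edges_at_eq_image_nbhd:
  assumes "simple_graph G" "v \<in> S"
  shows "{e \<in> edges_in G S. v \<in> e} = (\<lambda>u. {v, u}) ` nbhd G S v"
proof (intro equalityI subsetI)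
  fix e assume e: "e \<in> {e \<in> edges_in G S. v \<in> e}"
  then have "card e = 2"
    using assms(1) by (auto simp: edges_in_def simple_graph_def)
  then obtain u where "e = {v, u}"
    using e by (auto simp: card_2_iff)
  then show "e \<in> (\<lambda>u. {v, u}) ` nbhd G S v"
    using e by (auto simp: edges_in_def nbhd_def)
qed (use assms(2) in \<open>auto simp: edges_in_def nbhd_def\<close>)

lemma card_edges_at:
  assumes "simple_graph G" "v \<in> S"
  shows "card {e \<in> edges_in G S. v \<in> e} = card (nbhd G S v)"
  unfolding edges_at_eq_image_nbhd[OF assms]
  by (rule card_image) (auto simp: inj_on_def doubleton_eq_iff)

text \<open>The edges inside \<open>S\<close> split into those avoiding \<open>v\<close> and those
  through \<open>v\<close>, and the latter correspond to the neighbours of \<open>v\<close>. Every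
  vertex deletion below is counted by this identity.\<close>

lemma card_edges_in_remove:
  assumes "simple_graph G" "v \<in> S"
  shows "card (edges_in G S) = card (edges_in G (S - {v})) + card (nbhd G S v)"
proof -
  have "edges_in G S = edges_in G (S - {v}) \<union> {e \<in> edges_in G S. v \<in> e}"
    by (auto simp: edges_in_def)
  moreover have "edges_in G (S - {v}) \<inter> {e \<in> edges_in G S. v \<in> e} = {}"
    by (auto simp: edges_in_def)
  moreover have "finite (edges_in G T)" for T
    using finite_edges[OF assms(1)] by (simp add: edges_in_def)
  ultimately have "card (edges_in G S) =
      card (edges_in G (S - {v})) + card {e \<in> edges_in G S. v \<in> e}"
    using card_Un_disjoint[of "edges_in G (S - {v})" "{e \<in> edges_in G S. v \<in> e}"] by simp
  then show ?thesis
    by (simp add: card_edges_at[OF assms])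
qed

lemma edges_in_verts:
  assumes "simple_graph G"
  shows "edges_in G (verts G) = edges G"
  using assms by (auto simp: edges_in_def simple_graph_def)

text \<open>Handshake lemma, by double counting incidences of vertices and edges.\<close>

lemma sum_card_nbhd:
  assumes G: "simple_graph G"
  shows "(\<Sum>v\<in>verts G. card (nbhd G (verts G) v)) = 2 * card (edges G)"
proof -
  have "(\<Sum>v\<in>verts G. card (nbhd G (verts G) v)) = (\<Sum>v\<in>verts G. card {e \<in> edges G. v \<in> e})"
    by (intro sum.cong refl) (metis card_edges_at edges_in_verts G)
  also have "\<dots> = 2 * card (edges G)"
  proof (rule sum_multicount)
    show "\<forall>e\<in>edges G. card {v \<in> verts G. v \<in> e} = 2"
    proof
      fix e assume "e \<in> edges G"
      then have "card e = 2" "{v \<in> verts G. v \<in> e} = e"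
        using G by (auto simp: simple_graph_def)
      then show "card {v \<in> verts G. v \<in> e} = 2" by simp
    qed
  qed (use G finite_edges[OF G] in \<open>auto simp: simple_graph_def\<close>)
  finally show ?thesis .
qed

section \<open>Sparsity of critical graphs\<close>

lemma critical_low_degree:
  assumes G: "degree_3_critical G" and S: "S \<subset> verts G" "S \<noteq> {}"
  shows "\<exists>v\<in>S. card (nbhd G S v) \<le> 2"
proof (rule ccontr)
  assume "\<not> ?thesis"
  then have deg: "card (nbhd G S v) \<ge> 3" if "v \<in> S" for v
    using that by force
  let ?H = "(S, edges_in G S)"
  have simple: "simple_graph G"
    using G by (simp add: degree_3_critical_def)
  then have "finite S"
    using S finite_subset by (auto simp: simple_graph_def)
  then have "simple_graph ?H"
    using simple by (auto simp: simple_graph_def edges_in_def)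
  then have "induced_subgraph ?H G"
    using S by (auto simp: induced_subgraph_def subgraph_def edges_in_def)
  moreover have "min_degree ?H \<ge> 3"
    using deg \<open>finite S\<close> S(2)
    by (simp add: min_degree_def vertex_degree_def card_edges_at[OF simple])
  moreover have "?H \<noteq> G"
    using S(1) by (metis fst_conv psubset_eq)
  ultimately show False
    using G S(2) unfolding degree_3_critical_def by fastforce
qed

text \<open>Criticality always offers a vertex of degree at most 2 in \<open>S\<close>. Deleting it
  costs at most 2 edges, while the bound \<open>2 * card S - 3\<close> drops by exactly 2, so the
  bound is inherited from two-element sets.\<close>

lemma critical_card_edges_in:
  assumes G: "degree_3_critical G" and "S \<subset> verts G" "card S \<ge> 2"
  shows "card (edges_in G S) + 3 \<le> 2 * card S"
  using assms(2,3)
proof (induction "card S" arbitrary: S)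
  case 0
  then show ?case by simp
next
  case (Suc k)
  have simple: "simple_graph G"
    using G by (simp add: degree_3_critical_def)
  have "S \<noteq> {}" using Suc.prems(2) by auto
  then obtain v where v: "v \<in> S" "card (nbhd G S v) \<le> 2"
    using critical_low_degree[OF G Suc.prems(1)] by blast
  have card: "card (S - {v}) = k"
    using v Suc.hyps(2) by (simp add: card_Diff_singleton)
  show ?case
  proof (cases "k \<ge> 2")
    case True
    then have "card (edges_in G (S - {v})) + 3 \<le> 2 * card (S - {v})"
      using Suc.hyps(1) Suc.prems card by blast
    then show ?thesis
      using card_edges_in_remove[OF simple v(1)] v(2) card Suc.hyps(2) by linarith
  next
    case False
    \<comment> \<open>Base of the induction: two vertices span at most one edge, and 1 = 2 * 2 -
      3.\<close>
    then have "card S = 2"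
      using Suc.hyps(2) Suc.prems(2) by linarith
    then have "finite S"
      using card.infinite by fastforce
    have "edges_in G S \<subseteq> {S}"
    proof
      fix e assume "e \<in> edges_in G S"
      then have "e \<subseteq> S" "card e = card S"
        using simple \<open>card S = 2\<close> by (auto simp: edges_in_def simple_graph_def)
      then show "e \<in> {S}"
        using card_subset_eq[OF \<open>finite S\<close>] by simp
    qed
    then have "card (edges_in G S) \<le> 1"
      using card_mono[of "{S}"] by fastforce
    then show ?thesis
      using \<open>card S = 2\<close> by simp
  qed
qed

text \<open>If the low-degree vertex had fewer than two neighbours in \<open>S\<close>, the rest of
  \<open>S\<close> would exceed the sparsity bound. So its degree is exactly 2 and tightness passes
  to the smaller set. Three vertices are assumed because the bound applies from two vertices
  on.\<close>

lemma critical_tight_remove: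
  assumes G: "degree_3_critical G" and S: "S \<subset> verts G" "card S \<ge> 3"
    and tight: "card (edges_in G S) + 3 = 2 * card S"
  obtains w where "w \<in> S" "card (nbhd G S w) = 2"
    "card (edges_in G (S - {w})) + 3 = 2 * card (S - {w})"
proof -
  have simple: "simple_graph G"
    using G by (simp add: degree_3_critical_def)
  obtain w where w: "w \<in> S" "card (nbhd G S w) \<le> 2"
    using critical_low_degree[OF G S(1)] S(2) by fastforce
  have card: "card (S - {w}) + 1 = card S"
    using w(1) S(2) by (simp add: card_Diff_singleton)
  have "card (edges_in G (S - {w})) + 3 \<le> 2 * card (S - {w})"
    using critical_card_edges_in[OF G, of "S - {w}"] S card by auto
  then show ?thesis
    using that[OF w(1)] card_edges_in_remove[OF simple w(1)] tight card w(2) by linarith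
qed

section \<open>The three families\<close>

text \<open>Triangles sharing the spine \<open>{x, y}\<close>. Prescribing the whole neighbourhood
  of a leaf within \<open>S\<close> also makes the leaves pairwise nonadjacent; the next two
  definitions do the same.\<close>

definition book :: "'a ugraph \<Rightarrow> 'a set \<Rightarrow> 'a \<Rightarrow> 'a \<Rightarrow> 'a set \<Rightarrow> bool" where
  "book G S x y L \<longleftrightarrow> S = {x, y} \<union> L \<and> x \<noteq> y \<and> {x, y} \<inter> L = {} \<and> L \<noteq> {} \<and>
     {x, y} \<in> edges G \<and> (\<forall>l\<in>L. nbhd G S l = {x, y})"

text \<open>A triangle \<open>x y z\<close> with leaves on two of its sides, those meeting in
  \<open>x\<close>.\<close>

definition double_book :: "'a ugraph \<Rightarrow> 'a set \<Rightarrow> 'a \<Rightarrow> 'a \<Rightarrow> 'a \<Rightarrow> 'a set \<Rightarrow> 'a set \<Rightarrow> bool" where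
  "double_book G S x y z L M \<longleftrightarrow> S = {x, y, z} \<union> L \<union> M \<and> distinct [x, y, z] \<and>
     {x, y, z} \<inter> (L \<union> M) = {} \<and> L \<inter> M = {} \<and> L \<noteq> {} \<and> M \<noteq> {} \<and>
     {{x, y}, {x, z}, {y, z}} \<subseteq> edges G \<and>
     (\<forall>l\<in>L. nbhd G S l = {x, y}) \<and> (\<forall>l\<in>M. nbhd G S l = {x, z})"

text \<open>A four-cycle \<open>x a y b\<close> with the chord \<open>{a, b}\<close> as brace, and
  leaves joined to the opposite corners \<open>x\<close> and \<open>y\<close>. The pair
  \<open>{x, y}\<close> itself is left unconstrained.\<close>

definition braced_book :: "'a ugraph \<Rightarrow> 'a set \<Rightarrow> 'a \<Rightarrow> 'a \<Rightarrow> 'a \<Rightarrow> 'a \<Rightarrow> 'a set \<Rightarrow> bool" where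
  "braced_book G S x y a b L \<longleftrightarrow> S = {x, y, a, b} \<union> L \<and> distinct [x, y, a, b] \<and>
     {x, y, a, b} \<inter> L = {} \<and> L \<noteq> {} \<and>
     {{x, a}, {x, b}, {y, a}, {y, b}, {a, b}} \<subseteq> edges G \<and> (\<forall>l\<in>L. nbhd G S l = {x, y})"

abbreviation bookish :: "'a ugraph \<Rightarrow> 'a set \<Rightarrow> bool" where
  "bookish G S \<equiv> (\<exists>x y L. book G S x y L) \<or> (\<exists>x y z L M. double_book G S x y z L M) \<or>
     (\<exists>x y a b L. braced_book G S x y a b L)"

lemma book_swap: "book G S x y L \<Longrightarrow> book G S y x L"
  by (auto simp: book_def insert_commute)

lemma double_book_swap: "double_book G S x y z L M \<Longrightarrow> double_book G S x z y M L"
  by (auto simp: double_book_def insert_commute)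

lemma braced_book_swap:
  assumes "braced_book G S x y a b L"
  shows "braced_book G S y x a b L" "braced_book G S x y b a L"
  using assms by (auto simp: braced_book_def insert_commute)

lemma nbhd_edge: "nbhd G S l = N \<Longrightarrow> u \<in> N \<Longrightarrow> {l, u} \<in> edges G \<and> {u, l} \<in> edges G"
  by (auto simp: nbhd_def insert_commute)

text \<open>A new vertex changes the neighbourhoods of its own neighbours only, so leaves away from
  \<open>u\<close> and \<open>v\<close> remain leaves.\<close>

lemma nbhd_insert:
  assumes "nbhd G (insert w S) w = {u, v}" "l \<noteq> u" "l \<noteq> v" "l \<noteq> w" "l \<in> S"
  shows "nbhd G (insert w S) l = nbhd G S l"
proof -
  have "l \<notin> nbhd G (insert w S) w" using assms by auto
  then have "{l, w} \<notin> edges G" using assms(5) by (simp add: nbhd_def insert_commute)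
  then show ?thesis by (auto simp: nbhd_def)
qed

section \<open>Six-cycles through an additional vertex\<close>

text \<open>Strictness of the inclusion yields a third leaf \<open>k\<close>, and then
  \<open>w l x k y l'\<close> is a cycle.\<close>

lemma book_six_cycle:
  assumes B: "book G S x y L" and w: "w \<notin> S" "{w, l} \<in> edges G" "{w, l'} \<in> edges G"
    and L: "{l, l'} \<subset> L" "l \<noteq> l'"
  shows "has_six_cycle G"
proof -
  obtain k where k: "k \<in> L" "k \<noteq> l" "k \<noteq> l'"
    using L by blast
  have leaf: "{i, x} \<in> edges G \<and> {x, i} \<in> edges G \<and> {i, y} \<in> edges G \<and> {y, i} \<in> edges G"
    if "i \<in> L" for i
    using B that nbhd_edge[of G S i "{x, y}"] by (auto simp: book_def)
  show ?thesis
    by (rule six_cycleI[of w l _ x k y l'])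
      (use B w L k leaf in \<open>auto simp: book_def insert_commute\<close>)
qed

lemma double_book_six_cycle:
  assumes D: "double_book G S x y z L M" and w: "w \<notin> S" "{w, u} \<in> edges G" "{w, v} \<in> edges G"
    and uv: "u \<in> S" "v \<in> S" "u \<noteq> v" "{u, v} \<noteq> {x, y}" "{u, v} \<noteq> {x, z}"
  shows "has_six_cycle G"
proof -
  \<comment> \<open>This and the next two facts are stated for arbitrary \<open>y z L M\<close>, so
    that they also apply after exchanging the two sides by \<open>double_book_swap\<close>.\<close>
  have hub: "has_six_cycle G"
    if D: "double_book G S x y z L M" and w: "{w, u} \<in> edges G" "{w, v} \<in> edges G"
      and uv: "u \<in> {x, y, z}" "v \<in> L" for u v y z L M
  proof -
    obtain m where m: "m \<in> M" using D by (auto simp: double_book_def)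
    have e: "{v, x} \<in> edges G" "{v, y} \<in> edges G" "{m, x} \<in> edges G" "{m, z} \<in> edges G"
      "{x, y} \<in> edges G" "{x, z} \<in> edges G" "{y, z} \<in> edges G"
      using D uv m nbhd_edge[of G S v "{x, y}"] nbhd_edge[of G S m "{x, z}"]
      by (auto simp: double_book_def)
    have d: "distinct [w, x, y, z, v, m]"
      using D \<open>w \<notin> S\<close> uv m by (auto simp: double_book_def)
    consider "u = x" | "u = y" | "u = z" using uv by blast
    then show ?thesis
    proof cases
      case 1
      show ?thesis
        by (rule six_cycleI[of w x _ m z y v]) (use 1 w d e in \<open>auto simp: insert_commute\<close>)
    next
      case 2
      show ?thesis
        by (rule six_cycleI[of w y _ z m x v]) (use 2 w d e in \<open>auto simp: insert_commute\<close>)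
    next
      case 3
      show ?thesis
        by (rule six_cycleI[of w z _ m x y v]) (use 3 w d e in \<open>auto simp: insert_commute\<close>)
    qed
  qed
  have same_side: "has_six_cycle G"
    if D: "double_book G S x y z L M" and uv: "u \<in> L" "v \<in> L" for y z L M
  proof -
    have e: "{u, x} \<in> edges G" "{v, y} \<in> edges G" "{x, z} \<in> edges G" "{y, z} \<in> edges G"
      using D uv nbhd_edge[of G S u "{x, y}"] nbhd_edge[of G S v "{x, y}"]
      by (auto simp: double_book_def)
    show ?thesis
      by (rule six_cycleI[of w u _ x z y v])
        (use D w \<open>u \<noteq> v\<close> uv e in \<open>auto simp: double_book_def insert_commute\<close>)
  qed
  have opposite: "has_six_cycle G"
    if D: "double_book G S x y z L M" and uv: "u \<in> L" "v \<in> M" for y z L M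
  proof -
    have e: "{u, y} \<in> edges G" "{v, x} \<in> edges G" "{x, z} \<in> edges G" "{y, z} \<in> edges G"
      using D uv nbhd_edge[of G S u "{x, y}"] nbhd_edge[of G S v "{x, z}"]
      by (auto simp: double_book_def)
    show ?thesis
      by (rule six_cycleI[of w u _ y z x v])
        (use D w \<open>u \<noteq> v\<close> uv e in \<open>auto simp: double_book_def insert_commute\<close>)
  qed
  \<comment> \<open>The path from \<open>y\<close> to \<open>z\<close> goes around through one leaf
    on each side: \<open>y l x m z\<close>.\<close>
  have core: "has_six_cycle G" if "{u, v} = {y, z}"
  proof -
    obtain l m where lm: "l \<in> L" "m \<in> M" using D by (auto simp: double_book_def)
    have "{w, y} \<in> edges G" "{w, z} \<in> edges G"
      using w that by (auto simp: doubleton_eq_iff)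
    moreover have "{l, x} \<in> edges G" "{l, y} \<in> edges G" "{m, x} \<in> edges G" "{m, z} \<in> edges G"
      using D lm nbhd_edge[of G S l "{x, y}"] nbhd_edge[of G S m "{x, z}"]
      by (auto simp: double_book_def)
    ultimately show ?thesis
      by (intro six_cycleI[of w y _ l x m z])
        (use D \<open>w \<notin> S\<close> lm in \<open>auto simp: double_book_def insert_commute\<close>)
  qed
  have D': "double_book G S x z y M L"
    using D by (rule double_book_swap)
  have "S = {x, y, z} \<union> L \<union> M"
    using D by (simp add: double_book_def)
  then consider "u \<in> {x, y, z}" "v \<in> {x, y, z}" | "u \<in> {x, y, z}" "v \<in> L"
    | "u \<in> {x, y, z}" "v \<in> M" | "v \<in> {x, y, z}" "u \<in> L" | "v \<in> {x, y, z}" "u \<in> M"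
    | "u \<in> L" "v \<in> L" | "u \<in> M" "v \<in> M" | "u \<in> L" "v \<in> M" | "u \<in> M" "v \<in> L"
    using uv(1,2) by blast
  then show ?thesis
  proof cases
    case 1
    then have "{u, v} = {y, z}" using uv by (auto simp: doubleton_eq_iff)
    then show ?thesis by (rule core)
  next
    case 2 then show ?thesis by (intro hub[OF D w(2,3)])
  next
    case 3 then show ?thesis by (intro hub[OF D' w(2,3)]) auto
  next
    case 4 then show ?thesis by (intro hub[OF D w(3,2)])
  next
    case 5 then show ?thesis by (intro hub[OF D' w(3,2)]) auto
  next
    case 6 then show ?thesis by (rule same_side[OF D])
  next
    case 7 then show ?thesis by (rule same_side[OF D'])
  next
    case 8 then show ?thesis by (rule opposite[OF D])
  next
    case 9 then show ?thesis by (rule opposite[OF D'])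
  qed
qed

text \<open>Again \<open>u\<close> and \<open>v\<close> are joined by a path on five vertices inside
  \<open>S\<close>. Up to exchanging \<open>x\<close> with \<open>y\<close>, \<open>a\<close> with
  \<open>b\<close>, and \<open>u\<close> with \<open>v\<close>, five positions remain, settled in
  \<open>base\<close>.\<close>

lemma braced_book_six_cycle:
  assumes B: "braced_book G S x y a b L" and w: "w \<notin> S" "{w, u} \<in> edges G" "{w, v} \<in> edges G"
    and uv: "u \<in> S" "v \<in> S" "u \<noteq> v" "{u, v} \<noteq> {x, y}"
  shows "has_six_cycle G"
proof -
  obtain k where k: "k \<in> L" using B by (auto simp: braced_book_def)
  have base: "has_six_cycle G"
    if B: "braced_book G S x y a b L" and w: "{w, u} \<in> edges G" "{w, v} \<in> edges G"
      and uv: "u \<in> {x, a} \<and> v \<in> L \<or> u = x \<and> v = a \<or> u = a \<and> v = b \<or> u \<in> L \<and> v \<in> L" "u \<noteq> v"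
    for u v x y a b
  proof -
    have e: "{x, a} \<in> edges G" "{x, b} \<in> edges G" "{y, a} \<in> edges G" "{y, b} \<in> edges G"
      "{a, b} \<in> edges G"
      using B by (auto simp: braced_book_def)
    have leaf: "{i, x} \<in> edges G \<and> {i, y} \<in> edges G" if "i \<in> L" for i
      using B that nbhd_edge[of G S i "{x, y}"] by (auto simp: braced_book_def)
    have d: "distinct [w, x, y, a, b]" "\<And>i. i \<in> L \<Longrightarrow> i \<notin> {w, x, y, a, b}"
      using B \<open>w \<notin> S\<close> by (auto simp: braced_book_def)
    consider "u = x" "v \<in> L" | "u = a" "v \<in> L" | "u = x" "v = a" | "u = a" "v = b"
      | "u \<in> L" "v \<in> L"
      using uv by blast
    then show ?thesis
    proof cases
      case 1
      show ?thesis
        by (rule six_cycleI[of w x _ a b y v])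
          (use 1 w e d(1) d(2)[of v] leaf[of v] in \<open>auto simp: insert_commute\<close>)
    next
      case 2
      show ?thesis
        by (rule six_cycleI[of w a _ y b x v])
          (use 2 w e d(1) d(2)[of v] leaf[of v] in \<open>auto simp: insert_commute\<close>)
    next
      case 3
      show ?thesis
        by (rule six_cycleI[of w x _ k y b a])
          (use 3 k w e d(1) d(2)[of k] leaf[of k] in \<open>auto simp: insert_commute\<close>)
    next
      case 4
      show ?thesis
        by (rule six_cycleI[of w a _ x k y b])
          (use 4 k w e d(1) d(2)[of k] leaf[of k] in \<open>auto simp: insert_commute\<close>)
    next
      case 5
      show ?thesis
        by (rule six_cycleI[of w u _ x a y v])
          (use 5 uv(2) w e d(1) d(2)[of u] d(2)[of v] leaf[of u] leaf[of v] in
            \<open>auto simp: insert_commute\<close>)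
    qed
  qed
  have S: "S = {x, y, a, b} \<union> L"
    using B by (simp add: braced_book_def)
  note Bx = braced_book_swap(1)[OF B] and Ba = braced_book_swap(2)[OF B]
  note Bxa = braced_book_swap(2)[OF Bx]
  have sym: "has_six_cycle G"
    if w: "{w, u} \<in> edges G" "{w, v} \<in> edges G" and uv: "u \<noteq> v" "u \<in> S"
      and c: "v \<in> L \<or> u \<in> {x, y} \<and> v \<in> {a, b} \<or> u = a \<and> v = b" for u v
  proof -
    consider "u \<in> {x, a}" "v \<in> L" | "u \<in> {y, b}" "v \<in> L" | "u \<in> L" "v \<in> L"
      | "u = x" "v = a" | "u = x" "v = b" | "u = y" "v = a" | "u = y" "v = b" | "u = a" "v = b"
      using uv c unfolding S by blast
    then show ?thesis
      by cases (use uv(1) in \<open>simp_all add: base[OF B w] base[OF Bx w] base[OF Ba w] base[OF Bxa w]\<close>)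
  qed
  have "u \<in> {x, y, a, b} \<union> L" "v \<in> {x, y, a, b} \<union> L"
    using uv(1,2) unfolding S .
  \<comment> \<open>With \<open>{x, y}\<close> excluded, every pair has the shape required by
    \<open>sym\<close> in at least one of its two orders.\<close>
  then have "(v \<in> L \<or> u \<in> {x, y} \<and> v \<in> {a, b} \<or> u = a \<and> v = b) \<or>
      (u \<in> L \<or> v \<in> {x, y} \<and> u \<in> {a, b} \<or> v = a \<and> u = b)"
    using uv(3,4) by auto
  then show ?thesis
    using sym[OF w(2,3) uv(3,1)] sym[OF w(3,2) uv(3)[symmetric] uv(2)] by blast
qed

section \<open>Adding a vertex of degree 2 without creating a six-cycle\<close>

text \<open>The outcome depends on where \<open>w\<close> is attached: on the spine it is a new
  leaf; on a spine vertex and a leaf it gives a double book, or a book again if there was one leaf;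
  on two leaves it gives a braced book.\<close>

lemma book_extend:
  assumes G: "simple_graph G" and B: "book G S x y L" and w: "w \<notin> S"
    and N: "nbhd G (insert w S) w = {u, v}" and uv: "u \<in> S" "v \<in> S" "u \<noteq> v"
    and no_cycle: "\<not> has_six_cycle G"
  shows "bookish G (insert w S)"
proof -
  let ?W = "insert w S"
  have wuv: "{w, u} \<in> edges G" "{w, v} \<in> edges G"
    using N nbhd_edge[of G ?W w "{u, v}"] by auto
  have hub_leaf: "bookish G ?W"
    if B: "book G S x y L" and N: "nbhd G ?W w = {x, l}" and l: "l \<in> L" for x y l
  proof (cases "L = {l}")
    case True
    have e: "{x, y} \<in> edges G" "{l, x} \<in> edges G" "{l, y} \<in> edges G"
      using B l nbhd_edge[of G S l "{x, y}"] by (auto simp: book_def)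
    \<comment> \<open>With a single leaf, \<open>S\<close> is a triangle: its side
      \<open>{x, l}\<close> serves as the new spine, and \<open>y\<close> becomes a leaf next to
      \<open>w\<close>.\<close>
    have "nbhd G S y = {x, l}"
      using B True e edge_neq[OF G] by (auto simp: nbhd_def book_def insert_commute)
    moreover have "nbhd G ?W y = nbhd G S y"
      using B l w by (intro nbhd_insert[OF N]) (auto simp: book_def)
    ultimately have "book G ?W x l {y, w}"
      using B True N w e by (auto simp: book_def insert_commute)
    then show ?thesis by blast
  next
    case False
    have e: "{x, y} \<in> edges G" "{l, x} \<in> edges G" "{l, y} \<in> edges G"
      using B l nbhd_edge[of G S l "{x, y}"] by (auto simp: book_def)
    have "nbhd G ?W i = {x, y}" if "i \<in> L - {l}" for i
      using B that w nbhd_insert[OF N, of i] by (auto simp: book_def)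
    \<comment> \<open>The old leaf \<open>l\<close> is promoted to the third corner of the triangle:
      the other leaves stay on \<open>{x, y}\<close>, and \<open>w\<close> sits on
      \<open>{x, l}\<close>.\<close>
    then have "double_book G ?W x y l (L - {l}) {w}"
      using B l False N w e by (auto simp: double_book_def book_def insert_commute)
    then show ?thesis by blast
  qed
  have S: "S = {x, y} \<union> L"
    using B by (simp add: book_def)
  consider "{u, v} = {x, y}" | "u \<in> {x, y}" "v \<in> L" | "v \<in> {x, y}" "u \<in> L" | "u \<in> L" "v \<in> L"
    using uv unfolding S by blast
  then show ?thesis
  proof cases
    case 1
    have "nbhd G ?W i = {x, y}" if "i \<in> L" for i
      using B that w 1 nbhd_insert[OF N[unfolded 1], of i] by (auto simp: book_def)
    then have "book G ?W x y (insert w L)"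
      using B N 1 w by (auto simp: book_def)
    then show ?thesis by blast
  next
    case 2
    then show ?thesis
      using hub_leaf[OF B, of v] hub_leaf[OF book_swap[OF B], of v] N by blast
  next
    case 3
    have "nbhd G ?W w = {v, u}" using N by (simp add: insert_commute)
    with 3 show ?thesis
      using hub_leaf[OF B, of u] hub_leaf[OF book_swap[OF B], of u] by blast
  next
    case 4
    \<comment> \<open>A third leaf would close a six-cycle. The old spine \<open>{x, y}\<close> now
      becomes the brace, and \<open>u\<close>, \<open>v\<close> become the corners carrying the leaf
      \<open>w\<close>.\<close>
    have L: "L = {u, v}"
      using book_six_cycle[OF B w wuv] no_cycle uv(3) 4 by blast
    have "{u, x} \<in> edges G" "{u, y} \<in> edges G" "{v, x} \<in> edges G" "{v, y} \<in> edges G"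
      using B 4 nbhd_edge[of G S u "{x, y}"] nbhd_edge[of G S v "{x, y}"]
      by (auto simp: book_def)
    then have "braced_book G ?W u v x y {w}"
      using B N w L uv by (auto simp: braced_book_def book_def)
    then show ?thesis by blast
  qed
qed

text \<open>Avoiding a six-cycle forces \<open>w\<close> onto \<open>{x, y}\<close> or
  \<open>{x, z}\<close>, where it is one more leaf.\<close>

lemma double_book_extend:
  assumes D: "double_book G S x y z L M" and w: "w \<notin> S"
    and N: "nbhd G (insert w S) w = {u, v}" and uv: "u \<in> S" "v \<in> S" "u \<noteq> v"
    and no_cycle: "\<not> has_six_cycle G"
  shows "bookish G (insert w S)"
proof -
  let ?W = "insert w S"
  have wuv: "{w, u} \<in> edges G" "{w, v} \<in> edges G"
    using N nbhd_edge[of G ?W w "{u, v}"] by auto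
  have ext: "double_book G ?W x y z (insert w L) M"
    if D: "double_book G S x y z L M" and N: "nbhd G ?W w = {x, y}" for y z L M
  proof -
    have "nbhd G ?W i = nbhd G S i" if "i \<in> L \<union> M" for i
      using D that w by (intro nbhd_insert[OF N]) (auto simp: double_book_def)
    then show ?thesis
      using D N w by (auto simp: double_book_def)
  qed
  have "{u, v} = {x, y} \<or> {u, v} = {x, z}"
    using double_book_six_cycle[OF D w wuv uv] no_cycle by blast
  then show ?thesis
    using ext[OF D] ext[OF double_book_swap[OF D]] N by metis
qed

lemma braced_book_extend:
  assumes B: "braced_book G S x y a b L" and w: "w \<notin> S"
    and N: "nbhd G (insert w S) w = {u, v}" and uv: "u \<in> S" "v \<in> S" "u \<noteq> v"
    and no_cycle: "\<not> has_six_cycle G"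
  shows "bookish G (insert w S)"
proof -
  let ?W = "insert w S"
  have wuv: "{w, u} \<in> edges G" "{w, v} \<in> edges G"
    using N nbhd_edge[of G ?W w "{u, v}"] by auto
  have "{u, v} = {x, y}"
    using braced_book_six_cycle[OF B w wuv uv] no_cycle by blast
  with N have N': "nbhd G ?W w = {x, y}" by simp
  have "nbhd G ?W i = nbhd G S i" if "i \<in> L" for i
    using B that w by (intro nbhd_insert[OF N']) (auto simp: braced_book_def)
  then have "braced_book G ?W x y a b (insert w L)"
    using B N' w by (auto simp: braced_book_def)
  then show ?thesis by blast
qed

section \<open>Structure of tight sets\<close>

text \<open>Tight sets are built up by reversing \<open>critical_tight_remove\<close>: each step
  adds a vertex with exactly two neighbours, and the three extension lemmas keep the result within
  the families.\<close>

lemma critical_tight_bookish: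
  assumes G: "degree_3_critical G" and no_cycle: "\<not> has_six_cycle G"
    and "S \<subset> verts G" "card S \<ge> 3" "card (edges_in G S) + 3 = 2 * card S"
  shows "bookish G S"
  using assms(3-)
proof (induction "card S" arbitrary: S)
  case 0
  then show ?case by simp
next
  case (Suc k)
  have simple: "simple_graph G"
    using G by (simp add: degree_3_critical_def)
  obtain w where w: "w \<in> S" "card (nbhd G S w) = 2"
    and tight: "card (edges_in G (S - {w})) + 3 = 2 * card (S - {w})"
    using critical_tight_remove[OF G Suc.prems] .
  let ?T = "S - {w}"
  have card: "card ?T = k"
    using w(1) Suc.hyps(2) by (simp add: card_Diff_singleton)
  have S: "insert w ?T = S" "w \<notin> ?T"
    using w(1) by auto
  obtain u v where N: "nbhd G S w = {u, v}" "u \<noteq> v"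
    using w(2) by (auto simp: card_2_iff)
  have uv: "u \<in> ?T" "v \<in> ?T"
  proof -
    have "nbhd G S w \<subseteq> ?T"
      using edge_neq[OF simple, of w] by (auto simp: nbhd_def)
    then show "u \<in> ?T" "v \<in> ?T" using N by auto
  qed
  show ?case
  proof (cases "k \<ge> 3")
    case True
    have "?T \<subset> verts G"
      using Suc.prems(1) by blast
    then have "bookish G ?T"
      by (intro Suc.hyps(1)) (use True card tight in simp_all)
    then show ?thesis
      using book_extend[OF simple _ S(2) _ uv N(2) no_cycle]
        double_book_extend[OF _ S(2) _ uv N(2) no_cycle]
        braced_book_extend[OF _ S(2) _ uv N(2) no_cycle] unfolding S(1) using N(1) by metis
  next
    case False
    \<comment> \<open>Base of the induction: the two remaining vertices span one edge, so
      \<open>S\<close> is a triangle, which is a book with one leaf.\<close>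
    then have card_T: "card ?T = 2"
      using Suc.hyps(2) Suc.prems(2) card by linarith
    then have "finite ?T"
      by (metis card.infinite zero_neq_numeral)
    then have T: "?T = {u, v}"
      using uv N(2) card_T card_subset_eq[of ?T "{u, v}"] by simp
    have "card (edges_in G ?T) = 1"
      using tight card_T by simp
    then obtain e where e: "e \<in> edges_in G ?T"
      by (auto simp: card_1_singleton_iff)
    then have "card e = 2" "e \<subseteq> {u, v}"
      using simple T by (auto simp: edges_in_def simple_graph_def)
    then have "e = {u, v}"
      using card_subset_eq[of "{u, v}" e] N(2) by simp
    then have "{u, v} \<in> edges G"
      using e by (simp add: edges_in_def)
    then have "book G S u v {w}"
      using N T S by (auto simp: book_def)
    then show ?thesis by blast
  qed
qed

section \<open>The vertex of degree 3 and the conclusion\<close>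

text \<open>With n vertices, deleting one leaves at most 2(n - 1) - 3 = 2n - 5 of the 2n - 2 edges,
  so at least 3 are lost. Degrees all at least 4 would sum to at least 4n, but the sum is 4n -
  4.\<close>

lemma critical_degree_3_vertex:
  assumes G: "degree_3_critical G" and n: "card (verts G) \<ge> 3"
  shows "v \<in> verts G \<Longrightarrow> card (nbhd G (verts G) v) \<ge> 3"
    and "\<exists>v\<in>verts G. card (nbhd G (verts G) v) = 3"
proof -
  have simple: "simple_graph G" and e: "card (edges G) + 2 = 2 * card (verts G)"
    using G by (auto simp: degree_3_critical_def)
  show lower: "card (nbhd G (verts G) v) \<ge> 3" if v: "v \<in> verts G" for v
  proof -
    have "card (verts G - {v}) + 1 = card (verts G)"
      using v n by (simp add: card_Diff_singleton)
    moreover from this have "card (edges_in G (verts G - {v})) + 3 \<le> 2 * card (verts G - {v})"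
      using v n by (intro critical_card_edges_in[OF G]) auto
    ultimately show ?thesis
      using card_edges_in_remove[OF simple v] edges_in_verts[OF simple] e by simp
  qed
  show "\<exists>v\<in>verts G. card (nbhd G (verts G) v) = 3"
  proof (rule ccontr)
    assume "\<not> ?thesis"
    then have "card (nbhd G (verts G) v) \<ge> 4" if "v \<in> verts G" for v
      using lower[OF that] that by force
    then have "(\<Sum>v\<in>verts G. 4) \<le> (\<Sum>v\<in>verts G. card (nbhd G (verts G) v))"
      by (intro sum_mono)
    then show False
      using sum_card_nbhd[OF simple] e by simp
  qed
qed

theorem proposition5p1:
  fixes G :: "'a ugraph"
  assumes "degree_3_critical G"
    and "card (verts G) \<ge> 6"
  shows "contains_cycle_of_length G 6"
proof -
  let ?V = "verts G"
  have simple: "simple_graph G" and e: "card (edges G) + 2 = 2 * card ?V"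
    using assms(1) by (auto simp: degree_3_critical_def)
  have n: "card ?V \<ge> 3" using assms(2) by simp
  obtain v where v: "v \<in> ?V" "card (nbhd G ?V v) = 3"
    using critical_degree_3_vertex(2)[OF assms(1) n] by blast
  let ?S = "?V - {v}"
  have card_S: "card ?S + 1 = card ?V"
    using v(1) n by (simp add: card_Diff_singleton)
  then have tight: "card (edges_in G ?S) + 3 = 2 * card ?S"
    using card_edges_in_remove[OF simple v(1)] edges_in_verts[OF simple] e v(2) by simp
  have "?S \<subset> ?V" "card ?S \<ge> 3"
    using v(1) card_S assms(2) by auto
  then have dich: "has_six_cycle G \<or> bookish G ?S"
    using critical_tight_bookish[OF assms(1) _ _ _ tight] by satx
  \<comment> \<open>A vertex with two neighbours in \<open>?S\<close> has at least three in
    \<open>G\<close>, and only \<open>v\<close> can be the third.\<close>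
  have adj_leaf: "{v, l} \<in> edges G" if "l \<in> ?S" "card (nbhd G ?S l) = 2" for l
  proof (rule ccontr)
    assume "{v, l} \<notin> edges G"
    then have "nbhd G ?V l = nbhd G ?S l"
      by (auto simp: nbhd_def insert_commute)
    then show False
      using critical_degree_3_vertex(1)[OF assms(1) n, of l] that by simp
  qed
  have vS: "v \<notin> ?S" by simp
  have "has_six_cycle G" if "book G ?S x y L" for x y L
  proof -
    have S: "?S = {x, y} \<union> L" and leaf: "\<And>l. l \<in> L \<Longrightarrow> nbhd G ?S l = {x, y}" and "x \<noteq> y"
      and "{x, y} \<inter> L = {}"
      using that by (auto simp: book_def)
    have "card ?S \<le> 2 + card L"
      unfolding S using card_Un_le[of "{x, y}" L] \<open>x \<noteq> y\<close> by simp
    \<comment> \<open>This is where six vertices are used: \<open>?S\<close> has at least five, of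
      which two form the spine.\<close>
    then have "3 \<le> card L"
      using card_S assms(2) by linarith
    then obtain K where K: "K \<subseteq> L" "card K = 3"
      by (rule obtain_subset_with_card_n)
    then obtain l l' k where "K = {l, l', k}" "l \<noteq> l'" "k \<noteq> l" "k \<noteq> l'"
      by (auto simp: card_3_iff)
    moreover have "{v, i} \<in> edges G" if "i \<in> L" for i
      using adj_leaf[of i] leaf[OF that] S that \<open>x \<noteq> y\<close> by auto
    ultimately show ?thesis
      using book_six_cycle[OF that vS, of l l'] K by auto
  qed
  moreover have "has_six_cycle G" if D: "double_book G ?S x y z L M" for x y z L M
  proof -
    obtain l m where "l \<in> L" "m \<in> M"
      using D by (auto simp: double_book_def)
    \<comment> \<open>Leaves from opposite sides never form one of the two pairs excluded in
      \<open>double_book_six_cycle\<close>.\<close>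
    then have "l \<in> ?S" "m \<in> ?S" "l \<noteq> m" "{l, m} \<noteq> {x, y}" "{l, m} \<noteq> {x, z}"
      "card (nbhd G ?S l) = 2" "card (nbhd G ?S m) = 2"
      using D by (auto simp: double_book_def)
    then show ?thesis
      using double_book_six_cycle[OF D vS] adj_leaf by blast
  qed
  moreover have "has_six_cycle G" if B: "braced_book G ?S x y a b L" for x y a b L
  proof -
    obtain l where "l \<in> L"
      using B by (auto simp: braced_book_def)
    then have l: "l \<in> ?S" "l \<notin> {x, y}" "card (nbhd G ?S l) = 2"
      using B by (auto simp: braced_book_def)
    \<comment> \<open>There may be only one leaf, so the second neighbour \<open>t\<close> of
      \<open>v\<close> is arbitrary; since \<open>l\<close> is not in \<open>{x, y}\<close>, the
      pair \<open>{l, t}\<close> still differs from \<open>{x, y}\<close>.\<close>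
    have "\<not> nbhd G ?V v \<subseteq> {l}"
      using v(2) card_mono[of "{l}" "nbhd G ?V v"] by auto
    then obtain t where "t \<in> ?V" "{v, t} \<in> edges G" "t \<noteq> l"
      by (auto simp: nbhd_def)
    then show ?thesis
      using braced_book_six_cycle[OF B vS adj_leaf[OF l(1,3)], of t] l edge_neq[OF simple, of v t]
      by auto
  qed
  ultimately have "has_six_cycle G"
    using dich by blast
  then show ?thesis
    by (rule contains_cycle_if_has_six_cycle[OF simple])
qed

end
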